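(* Let $G$ be a connected bipartite graph with bipartition $V(G)=P\cup Q$, $|P|=p$, $|Q|=q$, $p+q=n$, and let $\Delta_P$ and $\Delta_Q$ be the maximum degrees among the vertices of $P$ and of $Q$, respectively. Then $$\rho^S(G)\ge\frac{3n-6+\sqrt{9n^2-36pq+4(5p-4\Delta_Q)(5q-4\Delta_P)}}{2},$$ with equality if and only if $G=K_{p,q}$, or $G$ is semi-regular and every vertex of $G$ has eccentricity $3$.
   Context: The distance Seidel matrix of a connected graph $G$ is $\mathcal{D}^S(G)=J-I-2\mathcal{D}(G)$, where $\mathcal{D}(G)$ is the distance matrix and $J$ the all-ones matrix; $\rho^S(G)=\max_i|\partial_i^S|$ over its eigenvalues (equivalently the largest eigenvalue of $-\mathcal{D}^S(G)$). A bipartite graph with parts $P,Q$ is semi-regular if all vertices of $P$ have the same degree and all vertices of $Q$ have the same degree. The eccentricity of a vertex is its maximum distance to the other vertices. *)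

theory Defs
  imports
    "Graph_Theory.Graph_Theory"
    "Jordan_Normal_Form.Spectral_Radius"
begin

text \<open>A finite simple undirected graph is a \<^locale>\<open>graph\<close> of the library: a finite symmetric
  digraph without loops and parallel arcs. Each edge is a pair of opposite arcs, so the degree of
  a vertex is its \<^const>\<open>out_degree\<close>.\<close>

text \<open>The number of edges of a shortest walk; finite in a connected graph.\<close>

definition graph_dist :: "('a, 'b) pre_digraph \<Rightarrow> 'a \<Rightarrow> 'a \<Rightarrow> real" where
  "graph_dist G u v = real_of_ereal (wf_digraph.\<mu> G (\<lambda>_. 1) u v)"

text \<open>The vertex itself, at distance 0, is included so that the maximum is over a nonempty set
  also in the one-vertex graph.\<close>

definition eccentricity :: "('a, 'b) pre_digraph \<Rightarrow> 'a \<Rightarrow> real" where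
  "eccentricity G v = Max (graph_dist G v ` verts G)"

definition bipartition :: "('a, 'b) pre_digraph \<Rightarrow> 'a set \<Rightarrow> 'a set \<Rightarrow> bool" where
  "bipartition G P Q \<longleftrightarrow>
     verts G = P \<union> Q \<and> P \<inter> Q = {} \<and> arcs_ends G \<subseteq> P \<times> Q \<union> Q \<times> P"

text \<open>The maximum over an empty part, which occurs only in the one-vertex graph, is 0.\<close>

definition max_degree_on :: "('a, 'b) pre_digraph \<Rightarrow> 'a set \<Rightarrow> nat" where
  "max_degree_on G S = Max (insert 0 (out_degree G ` S))"

definition semi_regular :: "('a, 'b) pre_digraph \<Rightarrow> 'a set \<Rightarrow> 'a set \<Rightarrow> bool" where
  "semi_regular G P Q \<longleftrightarrow>
     (\<exists>r. \<forall>v\<in>P. out_degree G v = r) \<and> (\<exists>s. \<forall>v\<in>Q. out_degree G v = s)"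

text \<open>Matrices are indexed by \<open>{0..<n}\<close>; the list \<open>vs\<close> enumerates the vertices of the graph.\<close>

definition distance_matrix :: "('a, 'b) pre_digraph \<Rightarrow> 'a list \<Rightarrow> real mat" where
  "distance_matrix G vs =
     mat (length vs) (length vs) (\<lambda>(i, j). graph_dist G (vs ! i) (vs ! j))"

definition all_ones_matrix :: "nat \<Rightarrow> real mat" where
  "all_ones_matrix n = mat n n (\<lambda>_. 1)"

definition distance_seidel_matrix :: "('a, 'b) pre_digraph \<Rightarrow> 'a list \<Rightarrow> real mat" where
  "distance_seidel_matrix G vs =
     all_ones_matrix (length vs) - 1\<^sub>m (length vs) - 2 \<cdot>\<^sub>m distance_matrix G vs"

text \<open>\<^const>\<open>spectral_radius\<close> is the maximum modulus over the complex eigenvalues, which are all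
  real because the matrix is real and symmetric.\<close>

definition distance_seidel_radius :: "('a, 'b) pre_digraph \<Rightarrow> 'a list \<Rightarrow> real" where
  "distance_seidel_radius G vs =
     spectral_radius (map_mat complex_of_real (distance_seidel_matrix G vs))"

end

theory Submission
  imports Defs
begin

text \<open>The matrix \<open>A = -D\<^sup>S\<close> is nonnegative, with zero diagonal and off-diagonal entries \<open>2 d(u, v) - 1\<close>.
  By parity, the row of \<open>u \<in> P\<close> has entries at least 3 within \<open>P\<close>, and its entries in \<open>Q\<close> are 1 at
  the neighbours of \<open>u\<close> and at least 5 elsewhere. So for \<open>z\<close> equal to \<open>x\<close> on \<open>P\<close> and \<open>y\<close> on \<open>Q\<close> the
  vector \<open>A z\<close> dominates the action on \<open>(x, y)\<close> of the matrix with rows \<open>(3(p-1), 5q - 4\<Delta>\<^sub>P)\<close> and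
  \<open>(5p - 4\<Delta>\<^sub>Q, 3(q-1))\<close>. The asserted bound \<open>r\<close> is its dominant eigenvalue; taking a positive
  eigenvector for \<open>(x, y)\<close> gives \<open>A z \<ge> r z\<close>, hence the bound on the spectral radius. Equality
  forces \<open>A z = r z\<close>: all degrees within a part agree and no distance exceeds 3.\<close>

section \<open>Collatz--Wielandt bounds for nonnegative matrices\<close>

lemma spectrum_smult_mat:
  fixes A :: "'a :: field mat"
  assumes A: "A \<in> carrier_mat n n" and c: "c \<noteq> 0"
  shows "spectrum (c \<cdot>\<^sub>m A) = (*) c ` spectrum A"
proof -
  have iff: "eigenvector (c \<cdot>\<^sub>m A) v (c * k) \<longleftrightarrow> eigenvector A v k" for v k
  proof (cases "v \<in> carrier_vec n")
    case True
    have *: "(c \<cdot>\<^sub>m A) *\<^sub>v v = c \<cdot>\<^sub>v (A *\<^sub>v v)"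
      using A True by (intro eq_vecI) auto
    have "c \<cdot>\<^sub>v (A *\<^sub>v v) = (c * k) \<cdot>\<^sub>v v \<longleftrightarrow> A *\<^sub>v v = k \<cdot>\<^sub>v v"
      using c A True by (auto simp: vec_eq_iff mult.assoc)
    then show ?thesis
      using A True * unfolding eigenvector_def by auto
  next
    case False
    then show ?thesis using A unfolding eigenvector_def by auto
  qed
  have "k \<in> spectrum (c \<cdot>\<^sub>m A) \<longleftrightarrow> k \<in> (*) c ` spectrum A" for k
  proof -
    have "k \<in> spectrum (c \<cdot>\<^sub>m A) \<longleftrightarrow> k / c \<in> spectrum A"
      using iff[of _ "k / c"] c unfolding spectrum_def eigenvalue_def by simp
    also have "\<dots> \<longleftrightarrow> k \<in> (*) c ` spectrum A"
      using c by (auto intro: image_eqI[where x = "k / c"])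
    finally show ?thesis .
  qed
  then show ?thesis by blast
qed

text \<open>Applied with two scalars: \<open>1 / s\<close> brings a spectral radius below 1, and
  \<open>- 1\<close> passes between the distance Seidel matrix and its nonnegative negative.\<close>

lemma spectral_radius_smult_mat:
  assumes A: "A \<in> carrier_mat n n" and n: "n > 0" and c: "c \<noteq> 0"
  shows "spectral_radius (c \<cdot>\<^sub>m A) = norm c * spectral_radius A"
proof -
  have "norm ` spectrum (c \<cdot>\<^sub>m A) = (*) (norm c) ` norm ` spectrum A"
    unfolding spectrum_smult_mat[OF A c] by (auto simp: image_iff norm_mult)
  moreover have "Max ((*) (norm c) ` norm ` spectrum A) = norm c * Max (norm ` spectrum A)"
    using card_finite_spectrum(1)[OF A] spectrum_non_empty[OF A n]
    by (intro mono_Max_commute[symmetric]) (auto intro!: monoI mult_left_mono)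
  ultimately show ?thesis unfolding spectral_radius_def by simp
qed

lemma nonneg_pow_mat:
  fixes A :: "real mat"
  assumes A: "A \<in> carrier_mat n n"
    and nn: "\<And>i j. i < n \<Longrightarrow> j < n \<Longrightarrow> 0 \<le> A $$ (i, j)"
  shows "i < n \<Longrightarrow> j < n \<Longrightarrow> 0 \<le> (A ^\<^sub>m k) $$ (i, j)"
proof (induction k arbitrary: i j)
  case 0
  then show ?case using A by simp
next
  case (Suc k)
  have Ak: "A ^\<^sub>m k \<in> carrier_mat n n" using A by simp
  show ?case
    using Suc Ak A nn by (auto simp: scalar_prod_def intro!: sum_nonneg)
qed

text \<open>The powers of \<open>A\<close> are entrywise nonnegative, so the one-step inequality may
  be inserted under the sum with weights \<open>A ^\<^sub>m k\<close>.\<close>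

lemma pow_mat_superinvariant:
  fixes A :: "real mat" and z :: "nat \<Rightarrow> real"
  assumes A: "A \<in> carrier_mat n n"
    and nn: "\<And>i j. i < n \<Longrightarrow> j < n \<Longrightarrow> 0 \<le> A $$ (i, j)"
    and t: "0 \<le> t"
    and super: "\<And>i. i < n \<Longrightarrow> t * z i \<le> (\<Sum>j<n. A $$ (i, j) * z j)"
  shows "i < n \<Longrightarrow> t ^ k * z i \<le> (\<Sum>j<n. (A ^\<^sub>m k) $$ (i, j) * z j)"
proof (induction k arbitrary: i)
  case 0
  have "(\<Sum>j<n. (A ^\<^sub>m 0) $$ (i, j) * z j) = (\<Sum>j<n. if j = i then z j else 0)"
    using 0 A by (intro sum.cong) auto
  then show ?case using 0 by simp
next
  case (Suc k)
  have Ak: "A ^\<^sub>m k \<in> carrier_mat n n" using A by simp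
  have "t ^ Suc k * z i = t * (t ^ k * z i)" by simp
  also have "\<dots> \<le> t * (\<Sum>l<n. (A ^\<^sub>m k) $$ (i, l) * z l)"
    using Suc t by (intro mult_left_mono) auto
  also have "\<dots> = (\<Sum>l<n. (A ^\<^sub>m k) $$ (i, l) * (t * z l))"
    by (simp add: sum_distrib_left algebra_simps)
  also have "\<dots> \<le> (\<Sum>l<n. (A ^\<^sub>m k) $$ (i, l) * (\<Sum>j<n. A $$ (l, j) * z j))"
    using Suc.prems nonneg_pow_mat[OF A nn] super by (intro sum_mono mult_left_mono) auto
  also have "\<dots> = (\<Sum>l<n. \<Sum>j<n. (A ^\<^sub>m k) $$ (i, l) * A $$ (l, j) * z j)"
    by (simp add: sum_distrib_left mult.assoc)
  also have "\<dots> = (\<Sum>j<n. \<Sum>l<n. (A ^\<^sub>m k) $$ (i, l) * A $$ (l, j) * z j)"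
    by (rule sum.swap)
  also have "\<dots> = (\<Sum>j<n. (A ^\<^sub>m Suc k) $$ (i, j) * z j)"
    using Suc.prems A Ak
    by (intro sum.cong) (auto simp: scalar_prod_def sum_distrib_right lessThan_atLeast0)
  finally show ?case .
qed

text \<open>Otherwise a suitable multiple of the matrix would have bounded powers but a superinvariant
  vector with factor greater than 1.\<close>

lemma spectral_radius_ge_superinvariant:
  fixes A :: "real mat" and z :: "nat \<Rightarrow> real"
  assumes A: "A \<in> carrier_mat n n" and n: "n > 0"
    and nn: "\<And>i j. i < n \<Longrightarrow> j < n \<Longrightarrow> 0 \<le> A $$ (i, j)"
    and z: "\<And>i. i < n \<Longrightarrow> 0 < z i"
    and super: "\<And>i. i < n \<Longrightarrow> r * z i \<le> (\<Sum>j<n. A $$ (i, j) * z j)"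
  shows "r \<le> spectral_radius (map_mat complex_of_real A)" (is "_ \<le> spectral_radius ?C")
proof (rule ccontr)
  assume "\<not> ?thesis"
  then have less: "spectral_radius ?C < r" by simp
  have C: "?C \<in> carrier_mat n n" using A by simp
  have "0 \<le> spectral_radius ?C"
    using spectral_radius_mem_max(1)[OF C n] by auto
  \<comment> \<open>Any \<open>s\<close> strictly between the radius and \<open>r\<close> serves:
    dividing by it makes the radius less than 1 and the superinvariance factor \<open>r / s\<close>
    greater than 1.\<close>
  then obtain s where s: "spectral_radius ?C < s" "s < r" "0 < s"
    using dense[OF less] by auto
  define B where "B = (1 / s) \<cdot>\<^sub>m A"
  have B: "B \<in> carrier_mat n n" using A by (simp add: B_def)
  have CB: "map_mat complex_of_real B = complex_of_real (1 / s) \<cdot>\<^sub>m ?C"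
    unfolding B_def by (intro eq_matI) auto
  have "spectral_radius (map_mat complex_of_real B) = spectral_radius ?C / s"
    unfolding CB using s by (subst spectral_radius_smult_mat[OF C n]) (auto simp: norm_divide)
  then have "spectral_radius (map_mat complex_of_real B) < 1" using s by simp
  \<comment> \<open>Spectral radius below 1 gives one bound \<open>c\<close> for the entries of all
    powers.\<close>
  then obtain c where c: "\<And>k. norm_bound (map_mat complex_of_real B ^\<^sub>m k) c"
    using spectral_radius_jnf_norm_bound_less_1_upper_triangular[of "map_mat complex_of_real B" n] B
    by auto
  have bound: "(B ^\<^sub>m k) $$ (i, j) \<le> c" if "i < n" "j < n" for i j k
  proof -
    have Bk: "B ^\<^sub>m k \<in> carrier_mat n n" using B by simp
    have "norm (map_mat complex_of_real (B ^\<^sub>m k) $$ (i, j)) \<le> c"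
      using c[of k] that B Bk unfolding of_real_hom.mat_hom_pow[OF B, symmetric] norm_bound_def
      by (simp del: index_map_mat(1) pow_mat_dim)
    moreover have "map_mat complex_of_real (B ^\<^sub>m k) $$ (i, j) = complex_of_real ((B ^\<^sub>m k) $$ (i, j))"
      using that Bk by (intro index_map_mat(1)) auto
    ultimately show ?thesis by simp
  qed
  have rs: "r / s > 1" using s by simp
  have Bsuper: "r / s * z i \<le> (\<Sum>j<n. B $$ (i, j) * z j)" if "i < n" for i
  proof -
    have "(\<Sum>j<n. B $$ (i, j) * z j) = (\<Sum>j<n. A $$ (i, j) * z j) / s"
      unfolding sum_divide_distrib using that A by (intro sum.cong) (auto simp: B_def)
    then show ?thesis using super[OF that] s by (simp add: divide_right_mono)
  qed
  \<comment> \<open>One row is enough: the left side grows geometrically in \<open>k\<close>, while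
    the right side does not depend on \<open>k\<close>.\<close>
  have ub: "(r / s) ^ k * z 0 \<le> (\<Sum>j<n. c * z j)" for k
  proof -
    have "(r / s) ^ k * z 0 \<le> (\<Sum>j<n. (B ^\<^sub>m k) $$ (0, j) * z j)"
      using n rs nn A s by (intro pow_mat_superinvariant[OF B _ _ Bsuper]) (auto simp: B_def)
    also have "\<dots> \<le> (\<Sum>j<n. c * z j)"
      using n bound z by (intro sum_mono mult_right_mono) (auto intro: less_imp_le)
    finally show ?thesis .
  qed
  obtain k where "(\<Sum>j<n. c * z j) / z 0 < (r / s) ^ k"
    using real_arch_pow[OF rs] by blast
  then show False using ub[of k] z[OF n] by (simp add: field_simps)
qed

text \<open>Take an eigenvector \<open>v\<close> for an eigenvalue of maximal modulus and compare
  \<open>|v|\<close> with \<open>z\<close> in the row where \<open>|v i| / z i\<close> is largest;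
  the triangle inequality there bounds the modulus.\<close>

lemma spectral_radius_le_subinvariant:
  fixes A :: "real mat" and z :: "nat \<Rightarrow> real"
  assumes A: "A \<in> carrier_mat n n" and n: "n > 0"
    and nn: "\<And>i j. i < n \<Longrightarrow> j < n \<Longrightarrow> 0 \<le> A $$ (i, j)"
    and z: "\<And>i. i < n \<Longrightarrow> 0 < z i"
    and sub: "\<And>i. i < n \<Longrightarrow> (\<Sum>j<n. A $$ (i, j) * z j) \<le> r * z i"
  shows "spectral_radius (map_mat complex_of_real A) \<le> r" (is "spectral_radius ?C \<le> _")
proof -
  have C: "?C \<in> carrier_mat n n" using A by simp
  obtain k where k: "eigenvalue ?C k" "spectral_radius ?C = norm k"
    using spectral_radius_mem_max(1)[OF C n] unfolding spectrum_def by auto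
  then obtain v where v: "v \<in> carrier_vec n" "v \<noteq> 0\<^sub>v n" "?C *\<^sub>v v = k \<cdot>\<^sub>v v"
    using C unfolding eigenvalue_def eigenvector_def by auto
  define m where "m = Max ((\<lambda>i. norm (v $ i) / z i) ` {..<n})"
  have le: "norm (v $ i) \<le> m * z i" if "i < n" for i
  proof -
    have "norm (v $ i) / z i \<le> m" unfolding m_def using that by (intro Max_ge) auto
    then show ?thesis using z[OF that] by (simp add: field_simps)
  qed
  have "m \<in> (\<lambda>i. norm (v $ i) / z i) ` {..<n}"
    unfolding m_def using n by (intro Max_in) auto
  then obtain i where i: "i < n" "m = norm (v $ i) / z i" by auto
  \<comment> \<open>Needed to cancel \<open>m * z i\<close> at the end; otherwise all entries of
    \<open>v\<close> would vanish.\<close>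
  have "m > 0"
  proof (rule ccontr)
    assume "\<not> m > 0"
    then have "norm (v $ j) \<le> 0" if "j < n" for j
      using le[OF that] z[OF that] by (meson mult_nonpos_nonneg less_imp_le not_less order_trans)
    then have "v = 0\<^sub>v n" using v(1) by (intro eq_vecI) auto
    then show False using v(2) by simp
  qed
  have "(?C *\<^sub>v v) $ i = (\<Sum>j<n. complex_of_real (A $$ (i, j)) * v $ j)"
    using i(1) v(1) A by (auto simp: scalar_prod_def lessThan_atLeast0 intro!: sum.cong)
  then have kv: "k * v $ i = (\<Sum>j<n. complex_of_real (A $$ (i, j)) * v $ j)"
    unfolding v(3) using i(1) v(1) by simp
  have "norm k * (m * z i) = norm (k * v $ i)"
    using i z[OF i(1)] by (simp add: norm_mult)
  also have "\<dots> \<le> (\<Sum>j<n. norm (complex_of_real (A $$ (i, j)) * v $ j))"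
    unfolding kv by (rule norm_sum)
  also have "\<dots> \<le> (\<Sum>j<n. A $$ (i, j) * (m * z j))"
    using nn i(1) le by (intro sum_mono) (auto simp: norm_mult intro!: mult_left_mono)
  also have "\<dots> = m * (\<Sum>j<n. A $$ (i, j) * z j)"
    by (simp add: sum_distrib_left algebra_simps)
  also have "\<dots> \<le> m * (r * z i)"
    using sub[OF i(1)] \<open>m > 0\<close> by (intro mult_left_mono) auto
  finally have "norm k * (m * z i) \<le> r * (m * z i)" by (simp add: algebra_simps)
  then have "norm k \<le> r" using \<open>m > 0\<close> z[OF i(1)] by (simp add: zero_less_mult_iff)
  then show ?thesis using k(2) by simp
qed

text \<open>With \<open>w = A z - r z\<close>, which is nonnegative and nonzero, \<open>z + A z\<close> is superinvariant with a
  factor greater than \<open>r\<close>, because \<open>A (z + A z) - r (z + A z) = w + A w\<close> is positive.\<close>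

lemma spectral_radius_gt_superinvariant:
  fixes A :: "real mat" and z :: "nat \<Rightarrow> real"
  assumes A: "A \<in> carrier_mat n n"
    and nn: "\<And>i j. i < n \<Longrightarrow> j < n \<Longrightarrow> 0 \<le> A $$ (i, j)"
    and pos: "\<And>i j. i < n \<Longrightarrow> j < n \<Longrightarrow> i \<noteq> j \<Longrightarrow> 0 < A $$ (i, j)"
    and z: "\<And>i. i < n \<Longrightarrow> 0 < z i"
    and super: "\<And>i. i < n \<Longrightarrow> r * z i \<le> (\<Sum>j<n. A $$ (i, j) * z j)"
    and i0: "i0 < n" "r * z i0 < (\<Sum>j<n. A $$ (i0, j) * z j)"
  shows "r < spectral_radius (map_mat complex_of_real A)"
proof -
  have n: "n > 0" using i0 by simp
  define w where "w i = (\<Sum>j<n. A $$ (i, j) * z j) - r * z i" for i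
  define y where "y i = z i + (\<Sum>j<n. A $$ (i, j) * z j)" for i
  have w: "0 \<le> w i" if "i < n" for i using super[OF that] by (simp add: w_def)
  have w0: "0 < w i0" using i0 by (simp add: w_def)
  have y: "0 < y i" if "i < n" for i
    unfolding y_def using that z nn
    by (intro add_pos_nonneg sum_nonneg) (auto intro!: mult_nonneg_nonneg less_imp_le[OF z])
  have Aw: "0 < w i + (\<Sum>j<n. A $$ (i, j) * w j)" if i: "i < n" for i
  proof (cases "i = i0")
    case True
    then show ?thesis using w0 w nn i by (intro add_pos_nonneg sum_nonneg) auto
  next
    case False
    \<comment> \<open>The positive off-diagonal entry carries the surplus of row \<open>i0\<close>
      into row \<open>i\<close>.\<close>
    have "0 < A $$ (i, i0) * w i0" using pos[OF i i0(1) False] w0 by simp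
    also have "\<dots> \<le> (\<Sum>j<n. A $$ (i, j) * w j)"
      using i i0 nn w by (intro member_le_sum) auto
    finally show ?thesis using w[OF i] by simp
  qed
  have eq: "(\<Sum>j<n. A $$ (i, j) * y j) - r * y i = w i + (\<Sum>j<n. A $$ (i, j) * w j)" for i
    unfolding y_def w_def
    by (simp add: sum.distrib sum_subtractf algebra_simps sum_distrib_left)
  \<comment> \<open>The least relative gain over the rows; a minimum of finitely many positive
    numbers, hence positive.\<close>
  define e where "e = Min ((\<lambda>i. ((\<Sum>j<n. A $$ (i, j) * y j) - r * y i) / y i) ` {..<n})"
  have "e > 0"
    unfolding e_def using n Aw y by (subst Min_gr_iff) (auto simp: eq)
  have "(r + e) * y i \<le> (\<Sum>j<n. A $$ (i, j) * y j)" if "i < n" for i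
  proof -
    have "e \<le> ((\<Sum>j<n. A $$ (i, j) * y j) - r * y i) / y i"
      unfolding e_def using that by (intro Min_le) auto
    then show ?thesis using y[OF that] by (simp add: field_simps)
  qed
  then have "r + e \<le> spectral_radius (map_mat complex_of_real A)"
    by (intro spectral_radius_ge_superinvariant[OF A n nn y]) auto
  then show ?thesis using \<open>e > 0\<close> by simp
qed

section \<open>Distances in connected bipartite graphs\<close>

text \<open>The entries of \<open>2 D - J + I\<close>, indexed by vertices rather than list
  positions so that row sums can be split over the two parts.\<close>

definition seidel_weight :: "('a, 'b) pre_digraph \<Rightarrow> 'a \<Rightarrow> 'a \<Rightarrow> real" where
  "seidel_weight G u v = 2 * graph_dist G u v - 1 + of_bool (u = v)"

locale connected_bipartite_graph = graph G for G (structure) +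
  fixes P Q :: "'a set"
  assumes connected: "Digraph_Component.connected G"
    and bipartition: "bipartition G P Q"
begin

lemma verts_eq: "verts G = P \<union> Q" and disjoint: "P \<inter> Q = {}"
  using bipartition unfolding bipartition_def by auto

lemma finite_parts: "finite P" "finite Q"
  using finite_verts unfolding verts_eq by auto

lemma not_in_part: "v \<in> P \<Longrightarrow> v \<notin> Q" "v \<in> Q \<Longrightarrow> v \<notin> P"
  using disjoint by auto

text \<open>Facts about vertices of \<open>P\<close> transfer to \<open>Q\<close> by interpreting
  the locale with the parts exchanged.\<close>

lemma swap: "connected_bipartite_graph G Q P"
proof
  show "bipartition G Q P" using bipartition unfolding bipartition_def by blast
qed (rule connected)

lemma arc_changes_part: "e \<in> arcs G \<Longrightarrow> tail G e \<in> P \<longleftrightarrow> head G e \<notin> P"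
proof -
  assume "e \<in> arcs G"
  then have "(tail G e, head G e) \<in> P \<times> Q \<union> Q \<times> P"
    using bipartition unfolding bipartition_def arcs_ends_conv by blast
  then show ?thesis using disjoint by auto
qed

lemma awalk_parity: "awalk u p v \<Longrightarrow> even (length p) \<longleftrightarrow> (u \<in> P \<longleftrightarrow> v \<in> P)"
proof (induction p arbitrary: u)
  case Nil
  then show ?case by (simp add: awalk_Nil_iff)
next
  case (Cons e p)
  then show ?case using arc_changes_part[of e] by (auto simp: awalk_Cons_iff)
qed

lemma awalk_cost_one: "awalk_cost (\<lambda>_. 1) p = real (length p)"
  by (induction p) auto

text \<open>Unit costs admit no negative cycle, and symmetry with connectedness gives reachability,
  so a path attains the infimum. In particular it is finite, and \<open>real_of_ereal\<close> loses
  nothing.\<close>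

lemma graph_dist_attained:
  assumes "u \<in> verts G" "v \<in> verts G"
  obtains p where "awalk u p v" "\<mu> (\<lambda>_. 1) u v = ereal (length p)" "graph_dist G u v = length p"
proof -
  have "u \<rightarrow>\<^sup>* v"
    using symmetric_connected_imp_strongly_connected[OF sym_arcs connected] assms by auto
  moreover have "\<not> awalk_cost (\<lambda>_. 1) c < 0" for c
    by (simp add: awalk_cost_one)
  ultimately obtain p where p: "apath u p v" "\<mu> (\<lambda>_. 1) u v = awalk_cost (\<lambda>_. 1) p"
    using no_neg_cyc_reach_imp_path[of u v "\<lambda>_. 1"] by blast
  then show ?thesis
    by (intro that[of p]) (auto simp: graph_dist_def awalk_cost_one intro: awalkI_apath)
qed

lemma graph_dist_le:
  assumes "awalk u p v"
  shows "graph_dist G u v \<le> length p"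
proof -
  obtain r where "awalk u r v"
    and r: "\<mu> (\<lambda>_. 1) u v = ereal (length r)" "graph_dist G u v = length r"
    by (rule graph_dist_attained[OF awalk_hd_in_verts[OF assms] awalk_last_in_verts[OF assms]])
  have "ereal (length r) \<le> ereal (length p)"
    using min_cost_le_walk_cost[OF assms, of "\<lambda>_. 1"] unfolding r(1) awalk_cost_one .
  then show ?thesis unfolding r(2) by simp
qed

lemma awalk_singleton_iff: "(\<exists>e. awalk u [e] v) \<longleftrightarrow> u \<rightarrow> v"
  by (auto simp: awalk_simps arcs_ends_conv image_iff)

text \<open>This collects what the weight estimates need: with the distance as a natural number of
  known parity, its small values can be handled by cases.\<close>

lemma graph_dist_nat:
  assumes "u \<in> verts G" "v \<in> verts G"
  obtains k :: nat where "graph_dist G u v = k" "even k \<longleftrightarrow> (u \<in> P \<longleftrightarrow> v \<in> P)"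
    "k = 0 \<longleftrightarrow> u = v" "k = 1 \<longleftrightarrow> u \<rightarrow> v"
proof -
  obtain p where p: "awalk u p v" "graph_dist G u v = length p"
    using graph_dist_attained[OF assms] by blast
  have zero: "length p = 0 \<longleftrightarrow> u = v"
  proof
    assume "u = v"
    then have "awalk u [] v" using assms by (simp add: awalk_Nil_iff)
    then show "length p = 0" using graph_dist_le[of u "[]" v] p(2) by simp
  qed (use p(1) in \<open>simp add: awalk_Nil_iff\<close>)
  have "length p = 1 \<longleftrightarrow> u \<rightarrow> v"
  proof
    assume "length p = 1"
    then obtain e where "p = [e]" by (auto simp: length_Suc_conv)
    then show "u \<rightarrow> v" using p(1) awalk_singleton_iff by blast
  next
    assume "u \<rightarrow> v"
    then obtain e where "awalk u [e] v" using awalk_singleton_iff by blast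
    moreover have "u \<noteq> v" using \<open>u \<rightarrow> v\<close> adj_not_same by blast
    ultimately show "length p = 1"
      using graph_dist_le[of u "[e]" v] p(2) zero by (cases "length p") auto
  qed
  then show ?thesis using that[of "length p"] p zero awalk_parity by blast
qed

section \<open>Neighbourhoods and maximum degrees\<close>

lemma out_degree_eq_card_neighbours: "out_degree G u = card {v. u \<rightarrow> v}"
proof -
  have "{v. u \<rightarrow> v} = head G ` out_arcs G u"
    by (auto simp: arcs_ends_conv image_iff)
  moreover have "inj_on (head G) (out_arcs G u)"
    using no_multi_arcs by (auto intro!: inj_onI simp: arc_to_ends_def)
  ultimately show ?thesis by (simp add: out_degree_def card_image)
qed

lemma neighbours_subset: "u \<in> P \<Longrightarrow> {v. u \<rightarrow> v} \<subseteq> Q"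
  using bipartition disjoint unfolding bipartition_def by auto

lemma out_degree_le_card: "u \<in> P \<Longrightarrow> out_degree G u \<le> card Q"
  unfolding out_degree_eq_card_neighbours
  by (rule card_mono[OF finite_parts(2) neighbours_subset])

lemma out_degree_eq_card_iff:
  assumes "u \<in> P"
  shows "out_degree G u = card Q \<longleftrightarrow> (\<forall>v\<in>Q. u \<rightarrow> v)"
proof -
  have "card {v. u \<rightarrow> v} = card Q \<longleftrightarrow> {v. u \<rightarrow> v} = Q"
    using neighbours_subset[OF assms] finite_parts(2) card_subset_eq by blast
  then show ?thesis
    using neighbours_subset[OF assms] unfolding out_degree_eq_card_neighbours by blast
qed

lemma out_degree_le_max: "u \<in> P \<Longrightarrow> out_degree G u \<le> max_degree_on G P"
  unfolding max_degree_on_def using finite_parts by (intro Max_ge) auto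

lemma max_degree_le_card: "max_degree_on G P \<le> card Q"
  unfolding max_degree_on_def using finite_parts out_degree_le_card by (intro Max.boundedI) auto

lemma max_degree_constant:
  assumes "P \<noteq> {}" "\<forall>v\<in>P. out_degree G v = r"
  shows "max_degree_on G P = r"
proof -
  have "out_degree G ` P = {r}" using assms by auto
  then show ?thesis by (simp add: max_degree_on_def)
qed

text \<open>The row sums are compared with those of the matrix whose entries are 0, 3, 1 and 5 for
  equal vertices, distinct vertices in one part, adjacent vertices, and non-adjacent vertices in
  different parts: the smallest values which parity allows.\<close>

lemma seidel_row_sum:
  fixes z :: "'a \<Rightarrow> real"
  assumes u: "u \<in> P" and x: "0 < x" and y: "0 < y"
    and zP: "\<And>v. v \<in> P \<Longrightarrow> z v = x" and zQ: "\<And>v. v \<in> Q \<Longrightarrow> z v = y"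
  defines "s \<equiv> 3 * (real (card P) - 1) * x
      + (5 * real (card Q) - 4 * real (max_degree_on G P)) * y"
  shows "s \<le> (\<Sum>v\<in>verts G. seidel_weight G u v * z v)"
    and "(\<Sum>v\<in>verts G. seidel_weight G u v * z v) = s \<longleftrightarrow>
      out_degree G u = max_degree_on G P \<and> (\<forall>v\<in>verts G. graph_dist G u v \<le> 3)"
proof -
  define b :: "'a \<Rightarrow> real" where
    "b v = (if v \<in> P then 3 - 3 * of_bool (v = u) else 5 - 4 * of_bool (u \<rightarrow> v))" for v
  have b: "b v \<le> seidel_weight G u v \<and> (seidel_weight G u v = b v \<longleftrightarrow> graph_dist G u v \<le> 3)"
    if v: "v \<in> verts G" for v
  proof -
    have uv: "u \<in> verts G" using u verts_eq by simp
    obtain k :: nat where k: "graph_dist G u v = k" "even k \<longleftrightarrow> (u \<in> P \<longleftrightarrow> v \<in> P)"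
      "k = 0 \<longleftrightarrow> u = v" "k = 1 \<longleftrightarrow> u \<rightarrow> v"
      using graph_dist_nat[OF uv v] by blast
    \<comment> \<open>The weight is \<open>2 k - 1\<close> for \<open>k > 0\<close>. Even
      \<open>k\<close> gives 0 or 3 when \<open>k \<le> 2\<close> and at least 7 otherwise; odd
      \<open>k\<close> gives 1 or 5 when \<open>k \<le> 3\<close> and at least 9 otherwise. So
      \<open>b v\<close> is exact precisely up to distance 3.\<close>
    show ?thesis
    proof (cases "v \<in> P")
      case True
      then have "even k" using k(2) u by simp
      then have "k = 0 \<or> k = 2 \<or> k \<ge> 4" by presburger
      then show ?thesis using k True by (auto simp: b_def seidel_weight_def)
    next
      case False
      then have "odd k" using k(2) u by simp
      then have "k = 1 \<or> k = 3 \<or> k \<ge> 5" by presburger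
      then show ?thesis using k False u by (auto simp: b_def seidel_weight_def)
    qed
  qed
  have z: "0 < z v" if "v \<in> verts G" for v
    using that x y zP zQ verts_eq by auto
  have "(\<Sum>v\<in>P. b v * z v) = (\<Sum>v\<in>P. (3 - 3 * of_bool (v = u)) * x)"
    using zP by (intro sum.cong) (auto simp: b_def)
  also have "\<dots> = (\<Sum>v\<in>P. 3 - 3 * of_bool (v = u)) * x"
    by (simp add: sum_distrib_right)
  also have "(\<Sum>v\<in>P. 3 - 3 * of_bool (v = u)) = 3 * (real (card P) - 1)"
    using u finite_parts by (simp add: sum_subtractf sum_distrib_left[symmetric] of_bool_def)
  finally have sumP: "(\<Sum>v\<in>P. b v * z v) = 3 * (real (card P) - 1) * x" .
  have "(\<Sum>v\<in>Q. b v * z v) = (\<Sum>v\<in>Q. (5 - 4 * of_bool (u \<rightarrow> v)) * y)"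
    using zQ not_in_part by (intro sum.cong) (auto simp: b_def)
  also have "\<dots> = (\<Sum>v\<in>Q. 5 - 4 * of_bool (u \<rightarrow> v)) * y"
    by (simp add: sum_distrib_right)
  also have "(\<Sum>v\<in>Q. 5 - 4 * of_bool (u \<rightarrow> v)) = 5 * real (card Q) - 4 * real (card {v \<in> Q. u \<rightarrow> v})"
    using finite_parts by (simp add: sum_subtractf sum_distrib_left[symmetric] Int_def)
  also have "{v \<in> Q. u \<rightarrow> v} = {v. u \<rightarrow> v}"
    using neighbours_subset[OF u] by blast
  finally have sumQ: "(\<Sum>v\<in>Q. b v * z v) = (5 * real (card Q) - 4 * real (out_degree G u)) * y"
    by (simp only: out_degree_eq_card_neighbours)
  \<comment> \<open>The row sum exceeds \<open>s\<close> by two nonnegative amounts: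
    \<open>t\<close>, from distances above 3, and a multiple of the degree deficit of
    \<open>u\<close>. Since \<open>z\<close> is positive, \<open>t\<close> vanishes only if every
    weight is minimal.\<close>
  define t where "t = (\<Sum>v\<in>verts G. (seidel_weight G u v - b v) * z v)"
  have nn: "0 \<le> (seidel_weight G u v - b v) * z v" if "v \<in> verts G" for v
    using b[OF that] z[OF that] by simp
  have t: "0 \<le> t" unfolding t_def using nn by (rule sum_nonneg)
  have t0: "t = 0 \<longleftrightarrow> (\<forall>v\<in>verts G. graph_dist G u v \<le> 3)"
    unfolding t_def using nn b z by (subst sum_nonneg_eq_0_iff) fastforce+
  have d: "0 \<le> 4 * (real (max_degree_on G P) - real (out_degree G u)) * y"
    using out_degree_le_max[OF u] y by simp
  have "(\<Sum>v\<in>verts G. b v * z v) = (\<Sum>v\<in>P. b v * z v) + (\<Sum>v\<in>Q. b v * z v)"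
    unfolding verts_eq using finite_parts disjoint by (intro sum.union_disjoint)
  then have eq: "(\<Sum>v\<in>verts G. seidel_weight G u v * z v)
      = s + t + 4 * (real (max_degree_on G P) - real (out_degree G u)) * y"
    unfolding t_def s_def left_diff_distrib sum_subtractf sumP sumQ by (simp add: algebra_simps)
  show "s \<le> (\<Sum>v\<in>verts G. seidel_weight G u v * z v)"
    unfolding eq using t d by linarith
  have "(\<Sum>v\<in>verts G. seidel_weight G u v * z v) = s \<longleftrightarrow>
      t = 0 \<and> 4 * (real (max_degree_on G P) - real (out_degree G u)) * y = 0"
    unfolding eq using t d by linarith
  also have "\<dots> \<longleftrightarrow> out_degree G u = max_degree_on G P \<and> (\<forall>v\<in>verts G. graph_dist G u v \<le> 3)"
    using t0 y by auto
  finally show "(\<Sum>v\<in>verts G. seidel_weight G u v * z v) = s \<longleftrightarrow>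
      out_degree G u = max_degree_on G P \<and> (\<forall>v\<in>verts G. graph_dist G u v \<le> 3)" .
qed

section \<open>Nonempty parts and the extremal graphs\<close>

lemma verts_nonempty: "verts G \<noteq> {}"
  using connected unfolding connected_conv by blast

lemma adj_sym: "u \<rightarrow> v \<longleftrightarrow> v \<rightarrow> u"
  using sym_arcs unfolding symmetric_def by (auto dest: symD)

text \<open>With an empty part there are no arcs, so connectedness leaves a single vertex.\<close>

lemma part_nonempty:
  assumes "card (verts G) \<noteq> 1"
  shows "P \<noteq> {}"
proof
  assume "P = {}"
  then have no_arc: "\<not> u \<rightarrow> v" for u v
    using bipartition unfolding bipartition_def by auto
  obtain u where u: "u \<in> verts G" using verts_nonempty by blast
  have "v = u" if v: "v \<in> verts G" for v
  proof -
    obtain p where "awalk u p v" using graph_dist_attained[OF u v] by blast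
    then show ?thesis using no_arc
      by (cases p) (auto simp: awalk_simps arcs_ends_conv)
  qed
  then have "verts G = {u}" using u by blast
  then show False using assms by simp
qed

text \<open>The library predicate only asserts that some bipartition with these sizes exists.
  Non-adjacent \<open>u \<in> P\<close> and \<open>v \<in> Q\<close> would lie on the same side of
  it and so have a common neighbour, which would belong to both \<open>Q\<close> and
  \<open>P\<close>.\<close>

lemma complete_bipartite_iff:
  assumes "P \<noteq> {}" "Q \<noteq> {}"
  shows "complete_bipartite_digraph (card P) (card Q) G \<longleftrightarrow> (\<forall>u\<in>P. \<forall>v\<in>Q. u \<rightarrow> v)"
proof
  assume "complete_bipartite_digraph (card P) (card Q) G"
  then obtain U V where UV: "verts G = U \<union> V" "card U = card P" "card V = card Q"
    "arcs_ends G = U \<times> V \<union> V \<times> U"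
    unfolding complete_bipartite_digraph_def by blast
  have ne: "U \<noteq> {}" "V \<noteq> {}"
    using UV assms finite_parts by (metis card_0_eq card.empty)+
  show "\<forall>u\<in>P. \<forall>v\<in>Q. u \<rightarrow> v"
  proof (intro ballI, rule ccontr)
    fix u v
    assume u: "u \<in> P" and v: "v \<in> Q" and na: "\<not> u \<rightarrow> v"
    have "u \<in> U \<union> V" "v \<in> U \<union> V" using u v verts_eq UV(1) by blast+
    then have "u \<in> U \<and> v \<in> U \<or> u \<in> V \<and> v \<in> V" using na unfolding UV(4) by blast
    then obtain w where "u \<rightarrow> w" "v \<rightarrow> w" using ne unfolding UV(4) by blast
    then show False
      using u v bipartition disjoint unfolding bipartition_def by blast
  qed
next
  assume all: "\<forall>u\<in>P. \<forall>v\<in>Q. u \<rightarrow> v"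
  have "arcs_ends G = P \<times> Q \<union> Q \<times> P"
    using all adj_sym bipartition unfolding bipartition_def by blast
  then show "complete_bipartite_digraph (card P) (card Q) G"
    unfolding complete_bipartite_digraph_def using graph_axioms verts_eq disjoint by blast
qed

lemma graph_dist_complete_le:
  assumes u: "u \<in> P" and v: "v \<in> verts G" and Q: "Q \<noteq> {}"
    and all: "\<forall>u\<in>P. \<forall>v\<in>Q. u \<rightarrow> v"
  shows "graph_dist G u v \<le> 3"
proof (cases "v \<in> P")
  case True
  obtain w where w: "w \<in> Q" using Q by blast
  then have "u \<rightarrow> w" "w \<rightarrow> v" using all u True adj_sym by blast+
  then obtain e f where "awalk u [e] w" "awalk w [f] v" using awalk_singleton_iff by blast
  then have "awalk u [e, f] v" by (auto simp: awalk_simps)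
  then show ?thesis using graph_dist_le[of u "[e, f]" v] by simp
next
  case False
  then have "u \<rightarrow> v" using u v all verts_eq by blast
  then obtain e where "awalk u [e] v" using awalk_singleton_iff by blast
  then show ?thesis using graph_dist_le[of u "[e]" v] by simp
qed

text \<open>A vertex missing some neighbour in the other part is at odd distance other than 1 from
  it, hence at distance at least 3.\<close>

lemma eccentricity_eq_3:
  assumes u: "u \<in> P" and le: "\<forall>v\<in>verts G. graph_dist G u v \<le> 3"
    and less: "out_degree G u < card Q"
  shows "eccentricity G u = 3"
proof -
  have uv: "u \<in> verts G" using u verts_eq by simp
  obtain v where v: "v \<in> Q" "\<not> u \<rightarrow> v" using out_degree_eq_card_iff[OF u] less by auto
  then have vv: "v \<in> verts G" using verts_eq by simp
  obtain k :: nat where k: "graph_dist G u v = k" "even k \<longleftrightarrow> (u \<in> P \<longleftrightarrow> v \<in> P)"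
    "k = 1 \<longleftrightarrow> u \<rightarrow> v"
    using graph_dist_nat[OF uv vv] by blast
  have "odd k" "k \<noteq> 1" using k v u not_in_part by auto
  then have "k \<ge> 3" by presburger
  then have "graph_dist G u v = 3" using le vv k(1) by (intro antisym) auto
  then show ?thesis unfolding eccentricity_def
    using vv le by (intro Max_eqI) (auto simp: image_iff intro!: bexI[of _ v])
qed

text \<open>Translates the rowwise equality conditions of \<open>seidel_row_sum\<close>, taken over
  both parts, into the two families of the theorem.\<close>

lemma extremal_iff:
  assumes P: "P \<noteq> {}" and Q: "Q \<noteq> {}"
  shows "(\<forall>u\<in>P. out_degree G u = max_degree_on G P) \<and> (\<forall>u\<in>Q. out_degree G u = max_degree_on G Q)
      \<and> (\<forall>u\<in>verts G. \<forall>v\<in>verts G. graph_dist G u v \<le> 3)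
    \<longleftrightarrow> complete_bipartite_digraph (card P) (card Q) G
      \<or> semi_regular G P Q \<and> (\<forall>v\<in>verts G. eccentricity G v = 3)"
    (is "?degP \<and> ?degQ \<and> ?dist \<longleftrightarrow> ?K \<or> ?S \<and> ?E")
proof -
  interpret Q: connected_bipartite_graph G Q P by (rule swap)
  have degs: "?degP \<and> ?degQ" if ?S
    using that max_degree_constant[OF P] Q.max_degree_constant[OF Q]
    unfolding semi_regular_def by metis
  show ?thesis
  proof
    assume L: "?degP \<and> ?degQ \<and> ?dist"
    then have S: ?S unfolding semi_regular_def by blast
    show "?K \<or> ?S \<and> ?E"
    proof (cases "\<forall>u\<in>P. \<forall>v\<in>Q. u \<rightarrow> v")
      case True
      then show ?thesis using complete_bipartite_iff[OF P Q] by blast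
    next
      case False
      \<comment> \<open>One non-adjacent pair suffices: since degrees are constant on each part,
        every vertex then misses some vertex of the opposite part.\<close>
      then obtain u v where uv: "u \<in> P" "v \<in> Q" "\<not> u \<rightarrow> v" by blast
      have "max_degree_on G P \<noteq> card Q" using L uv out_degree_eq_card_iff by metis
      then have lessP: "max_degree_on G P < card Q" using max_degree_le_card by simp
      have "max_degree_on G Q \<noteq> card P" using L uv Q.out_degree_eq_card_iff adj_sym by metis
      then have lessQ: "max_degree_on G Q < card P" using Q.max_degree_le_card by simp
      have "eccentricity G w = 3" if "w \<in> verts G" for w
        using that L lessP lessQ eccentricity_eq_3[of w] Q.eccentricity_eq_3[of w]
        unfolding verts_eq by auto
      then show ?thesis using S by blast
    qed
  next
    assume "?K \<or> ?S \<and> ?E"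
    then show "?degP \<and> ?degQ \<and> ?dist"
    proof
      assume ?K
      then have all: "\<forall>u\<in>P. \<forall>v\<in>Q. u \<rightarrow> v" and all': "\<forall>u\<in>Q. \<forall>v\<in>P. u \<rightarrow> v"
        using complete_bipartite_iff[OF P Q] adj_sym by blast+
      have ?S unfolding semi_regular_def
        using all all' out_degree_eq_card_iff Q.out_degree_eq_card_iff by blast
      moreover have ?dist
        using graph_dist_complete_le[OF _ _ Q all] Q.graph_dist_complete_le[OF _ _ P all']
        unfolding verts_eq by blast
      ultimately show ?thesis using degs by blast
    next
      assume R: "?S \<and> ?E"
      have "graph_dist G u v \<le> 3" if "u \<in> verts G" "v \<in> verts G" for u v
      proof -
        have "graph_dist G u v \<le> eccentricity G u"
          unfolding eccentricity_def using that by (intro Max_ge) auto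
        then show ?thesis using R that by simp
      qed
      then show ?thesis using degs R by blast
    qed
  qed
qed

section \<open>Signs of the weights, as the comparison lemmas require\<close>

lemma seidel_weight_self: "v \<in> verts G \<Longrightarrow> seidel_weight G v v = 0"
  using graph_dist_nat[of v v] by (auto simp: seidel_weight_def)

lemma seidel_weight_pos:
  assumes "u \<in> verts G" "v \<in> verts G" "u \<noteq> v"
  shows "0 < seidel_weight G u v"
proof -
  obtain k :: nat where "graph_dist G u v = k" "k = 0 \<longleftrightarrow> u = v"
    using graph_dist_nat[OF assms(1,2)] by blast
  then show ?thesis using assms(3) by (cases k) (auto simp: seidel_weight_def)
qed

lemma seidel_weight_nonneg: "u \<in> verts G \<Longrightarrow> v \<in> verts G \<Longrightarrow> 0 \<le> seidel_weight G u v"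
  using seidel_weight_self seidel_weight_pos by (metis less_imp_le order_refl)

end

section \<open>The distance Seidel radius\<close>

definition seidel_weight_matrix :: "('a, 'b) pre_digraph \<Rightarrow> 'a list \<Rightarrow> real mat" where
  "seidel_weight_matrix G vs =
     mat (length vs) (length vs) (\<lambda>(i, j). seidel_weight G (vs ! i) (vs ! j))"

lemma seidel_weight_matrix_carrier [simp]:
  "seidel_weight_matrix G vs \<in> carrier_mat (length vs) (length vs)"
  by (simp add: seidel_weight_matrix_def)

lemma seidel_weight_matrix_index [simp]:
  "i < length vs \<Longrightarrow> j < length vs \<Longrightarrow>
    seidel_weight_matrix G vs $$ (i, j) = seidel_weight G (vs ! i) (vs ! j)"
  by (simp add: seidel_weight_matrix_def)

text \<open>The two matrices differ by the factor -1, which preserves moduli. Distinctness of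
  \<open>vs\<close> makes equality of vertices the same as equality of indices, so that
  \<open>of_bool\<close> yields the identity matrix.\<close>

lemma distance_seidel_radius_eq:
  assumes "distinct vs" "vs \<noteq> []"
  shows "distance_seidel_radius G vs
    = spectral_radius (map_mat complex_of_real (seidel_weight_matrix G vs))"
proof -
  have "map_mat complex_of_real (distance_seidel_matrix G vs)
      = (- 1) \<cdot>\<^sub>m map_mat complex_of_real (seidel_weight_matrix G vs)"
    using assms(1)
    by (intro eq_matI)
      (auto simp: distance_seidel_matrix_def all_ones_matrix_def distance_matrix_def
        seidel_weight_matrix_def seidel_weight_def nth_eq_iff_index_eq)
  then show ?thesis
    using assms(2) spectral_radius_smult_mat[of
        "map_mat complex_of_real (seidel_weight_matrix G vs)" "length vs" "- 1"]
    by (simp add: distance_seidel_radius_def)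
qed

lemma seidel_weight_matrix_row_sum:
  assumes "distinct vs" "i < length vs"
  shows "(\<Sum>j<length vs. seidel_weight_matrix G vs $$ (i, j) * f (vs ! j))
    = (\<Sum>v\<in>set vs. seidel_weight G (vs ! i) v * f v)"
proof -
  have "bij_betw ((!) vs) {..<length vs} (set vs)"
    using assms(1) by (rule bij_betw_nth) auto
  from sum.reindex_bij_betw[OF this, of "\<lambda>v. seidel_weight G (vs ! i) v * f v"]
  show ?thesis using assms(2) by simp
qed

context connected_bipartite_graph
begin

text \<open>Carries the comparison lemmas over to functions on vertices. Strict excess in a single
  row would push the radius above \<open>r\<close>; equality in all rows makes \<open>z\<close>
  subinvariant as well.\<close>

lemma distance_seidel_radius_bounds:
  fixes z :: "'a \<Rightarrow> real"
  assumes vs: "distinct vs" "set vs = verts G"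
    and z: "\<And>v. v \<in> verts G \<Longrightarrow> 0 < z v"
    and super: "\<And>u. u \<in> verts G \<Longrightarrow> r * z u \<le> (\<Sum>v\<in>verts G. seidel_weight G u v * z v)"
  shows "r \<le> distance_seidel_radius G vs"
    and "distance_seidel_radius G vs = r \<longleftrightarrow>
      (\<forall>u\<in>verts G. (\<Sum>v\<in>verts G. seidel_weight G u v * z v) = r * z u)"
proof -
  let ?A = "seidel_weight_matrix G vs" and ?n = "length vs" and ?z = "\<lambda>i. z (vs ! i)"
  have n: "vs \<noteq> []" "0 < ?n" using verts_nonempty vs(2) by auto
  note A = seidel_weight_matrix_carrier[of G vs]
  have in_verts: "vs ! i \<in> verts G" if "i < ?n" for i
    using nth_mem[OF that] vs(2) by simp
  have nn: "0 \<le> ?A $$ (i, j)" if "i < ?n" "j < ?n" for i j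
    using that in_verts seidel_weight_nonneg by simp
  have pos: "0 < ?A $$ (i, j)" if "i < ?n" "j < ?n" "i \<noteq> j" for i j
    using that in_verts vs(1) seidel_weight_pos by (simp add: nth_eq_iff_index_eq)
  have zpos: "0 < ?z i" if "i < ?n" for i
    using that in_verts z by simp
  have row: "(\<Sum>j<?n. ?A $$ (i, j) * ?z j) = (\<Sum>v\<in>verts G. seidel_weight G (vs ! i) v * z v)"
    if "i < ?n" for i
    using seidel_weight_matrix_row_sum[OF vs(1) that, of G z] vs(2) by simp
  have Asuper: "r * ?z i \<le> (\<Sum>j<?n. ?A $$ (i, j) * ?z j)" if "i < ?n" for i
    using super[OF in_verts[OF that]] row[OF that] by simp
  have radius: "distance_seidel_radius G vs = spectral_radius (map_mat complex_of_real ?A)"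
    using distance_seidel_radius_eq vs(1) n(1) by blast
  show ge: "r \<le> distance_seidel_radius G vs"
    unfolding radius using spectral_radius_ge_superinvariant[OF A n(2) nn zpos Asuper] .
  show "distance_seidel_radius G vs = r \<longleftrightarrow>
      (\<forall>u\<in>verts G. (\<Sum>v\<in>verts G. seidel_weight G u v * z v) = r * z u)"
  proof
    assume eq: "distance_seidel_radius G vs = r"
    show "\<forall>u\<in>verts G. (\<Sum>v\<in>verts G. seidel_weight G u v * z v) = r * z u"
    proof (intro ballI, rule ccontr)
      fix u
      assume u: "u \<in> verts G" and ne: "(\<Sum>v\<in>verts G. seidel_weight G u v * z v) \<noteq> r * z u"
      obtain i where i: "i < ?n" "vs ! i = u" using u vs(2) by (metis in_set_conv_nth)
      have "r * ?z i < (\<Sum>j<?n. ?A $$ (i, j) * ?z j)"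
        unfolding row[OF i(1)] using i(2) ne super[OF u] by simp
      then have "r < distance_seidel_radius G vs"
        unfolding radius
        using spectral_radius_gt_superinvariant[where z = ?z, OF A nn pos zpos Asuper i(1)] by blast
      then show False using eq by simp
    qed
  next
    assume eq: "\<forall>u\<in>verts G. (\<Sum>v\<in>verts G. seidel_weight G u v * z v) = r * z u"
    have "(\<Sum>j<?n. ?A $$ (i, j) * ?z j) \<le> r * ?z i" if "i < ?n" for i
      using eq in_verts[OF that] row[OF that] by simp
    then have "distance_seidel_radius G vs \<le> r"
      unfolding radius by (intro spectral_radius_le_subinvariant[OF A n(2) nn zpos])
    then show "distance_seidel_radius G vs = r" using ge by simp
  qed
qed

end

text \<open>Here \<open>r\<close> is the larger root of the characteristic equation of the matrix
  with rows \<open>(a, b)\<close> and \<open>(c, d)\<close>. The bound \<open>a < r\<close> makes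
  its eigenvector \<open>(b, r - a)\<close> positive.\<close>

lemma two_by_two_dominant_eigenvalue:
  fixes a b c d :: real
  assumes "0 < b" "0 < c"
  defines "r \<equiv> (a + d + sqrt ((a - d)\<^sup>2 + 4 * b * c)) / 2"
  shows "a < r" "(r - a) * (r - d) = b * c"
proof -
  have bc: "0 < b * c" using assms by simp
  define S where "S = sqrt ((a - d)\<^sup>2 + 4 * b * c)"
  have r: "2 * r = a + d + S" unfolding r_def S_def by simp
  have "a - d < S"
    unfolding S_def using bc by (intro real_less_rsqrt) simp
  then show "a < r" using r by linarith
  have "(2 * r - (a + d))\<^sup>2 = (a - d)\<^sup>2 + 4 * b * c"
    unfolding r S_def using bc by simp
  then show "(r - a) * (r - d) = b * c"
    by (simp add: power2_eq_square algebra_simps)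
qed

theorem theorem4p5:
  fixes G :: "('a, 'b) pre_digraph"
    and P Q :: "'a set"
    and vs :: "'a list"
    and n p q :: nat
  assumes "graph G"
    and "Digraph_Component.connected G"
    and "bipartition G P Q"
    and "card P = p"
    and "card Q = q"
    and "p + q = n"
    and "distinct vs"
    and "set vs = verts G"
  shows "distance_seidel_radius G vs \<ge>
           (3 * real n - 6 + sqrt (9 * (real n)\<^sup>2 - 36 * real p * real q
              + 4 * (5 * real p - 4 * real (max_degree_on G Q))
                  * (5 * real q - 4 * real (max_degree_on G P)))) / 2
       \<and> (distance_seidel_radius G vs =
           (3 * real n - 6 + sqrt (9 * (real n)\<^sup>2 - 36 * real p * real q
              + 4 * (5 * real p - 4 * real (max_degree_on G Q))
                  * (5 * real q - 4 * real (max_degree_on G P)))) / 2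
          \<longleftrightarrow> complete_bipartite_digraph p q G
            \<or> (semi_regular G P Q \<and> (\<forall>v\<in>verts G. eccentricity G v = 3)))"
proof -
  interpret connected_bipartite_graph G P Q
    using assms(1-3) by (simp add: connected_bipartite_graph_def connected_bipartite_graph_axioms_def)
  interpret Q: connected_bipartite_graph G Q P by (rule swap)
  define a where "a = 3 * (real p - 1)"
  define d where "d = 3 * (real q - 1)"
  define b where "b = 5 * real q - 4 * real (max_degree_on G P)"
  define c where "c = 5 * real p - 4 * real (max_degree_on G Q)"
  define r where "r = (a + d + sqrt ((a - d)\<^sup>2 + 4 * b * c)) / 2"
  \<comment> \<open>Both \<open>9 n^2 - 36 p q\<close> and \<open>(a - d)^2\<close> equal
    \<open>9 (p - q)^2\<close>.\<close>
  have "9 * (real n)\<^sup>2 - 36 * real p * real q + 4 * c * b = (a - d)\<^sup>2 + 4 * b * c"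
    unfolding a_def d_def assms(6)[symmetric] by (simp add: power2_eq_square algebra_simps)
  moreover have "3 * real n - 6 = a + d"
    unfolding a_def d_def assms(6)[symmetric] by simp
  ultimately have formula: "(3 * real n - 6 + sqrt (9 * (real n)\<^sup>2 - 36 * real p * real q
              + 4 * (5 * real p - 4 * real (max_degree_on G Q))
                  * (5 * real q - 4 * real (max_degree_on G P)))) / 2 = r"
    unfolding r_def b_def[symmetric] c_def[symmetric] by simp
  have card_verts: "card (verts G) = n"
    using finite_parts disjoint assms(4-6) unfolding verts_eq by (simp add: card_Un_disjoint)
  have "r \<le> distance_seidel_radius G vs \<and> (distance_seidel_radius G vs = r \<longleftrightarrow>
      complete_bipartite_digraph p q G
        \<or> semi_regular G P Q \<and> (\<forall>v\<in>verts G. eccentricity G v = 3))"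
  proof (cases "n = 1")
    case True
    then obtain u where u: "verts G = {u}" using card_verts by (metis card_1_singletonE)
    have no_arc: "arcs_ends G = {}"
    proof -
      have False if "e \<in> arcs G" for e
        using wellformed[OF that] no_loops[OF that] u by simp
      then show ?thesis unfolding arcs_ends_conv by blast
    qed
    have "p = 0 \<and> q = 1 \<or> p = 1 \<and> q = 0" using True assms(6) by auto
    then have parts: "P = {} \<or> Q = {}" "b * c = 0" "(a - d)\<^sup>2 = 3\<^sup>2" "a + d = - 3"
      using assms(4,5) finite_parts max_degree_le_card Q.max_degree_le_card
      by (auto simp: a_def b_def c_def d_def)
    have "r = 0" unfolding r_def mult.assoc parts by simp
    have w0: "seidel_weight G u u = 0" using seidel_weight_self u by simp
    have "complete_bipartite_digraph p q G"
      unfolding complete_bipartite_digraph_def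
      using graph_axioms verts_eq disjoint assms(4,5) no_arc parts(1) by blast
    then show ?thesis
      using distance_seidel_radius_bounds[of vs "\<lambda>_. 1" r] assms(7,8) u w0 \<open>r = 0\<close> by simp
  next
    case False
    then have ne: "P \<noteq> {}" "Q \<noteq> {}"
      using part_nonempty Q.part_nonempty card_verts by auto
    then have "0 < p" "0 < q" using assms(4,5) finite_parts by (auto simp: card_gt_0_iff)
    \<comment> \<open>A degree is at most the size of the opposite part, so \<open>b \<ge> q\<close>
      and \<open>c \<ge> p\<close>.\<close>
    then have bc: "0 < b" "0 < c"
      using max_degree_le_card Q.max_degree_le_card assms(4,5) by (auto simp: b_def c_def)
    note r = two_by_two_dominant_eigenvalue[OF bc, of a d, folded r_def]
    define z where "z v = (if v \<in> P then b else r - a)" for v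
    have zP: "z v = b" if "v \<in> P" for v using that by (simp add: z_def)
    have zQ: "z v = r - a" if "v \<in> Q" for v using that not_in_part by (simp add: z_def)
    have rz: "0 < r - a" using r(1) by simp
    have z: "0 < z v" if "v \<in> verts G" for v using bc(1) rz by (simp add: z_def)
    \<comment> \<open>\<open>rP\<close> and \<open>rQ\<close> are the two coordinates of the
      eigenvector equation for \<open>(b, r - a)\<close>; the second one uses
      \<open>(r - a) * (r - d) = b * c\<close>.\<close>
    have rP: "3 * (real (card P) - 1) * b
        + (5 * real (card Q) - 4 * real (max_degree_on G P)) * (r - a) = r * b"
      unfolding assms(4,5) a_def[symmetric] b_def[symmetric] by (simp add: algebra_simps)
    have rQ: "3 * (real (card Q) - 1) * (r - a)
        + (5 * real (card P) - 4 * real (max_degree_on G Q)) * b = r * (r - a)"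
      unfolding assms(4,5) d_def[symmetric] c_def[symmetric] using r(2) by (simp add: algebra_simps)
    have P: "r * z u \<le> (\<Sum>v\<in>verts G. seidel_weight G u v * z v)"
      "(\<Sum>v\<in>verts G. seidel_weight G u v * z v) = r * z u \<longleftrightarrow>
        out_degree G u = max_degree_on G P \<and> (\<forall>v\<in>verts G. graph_dist G u v \<le> 3)"
      if "u \<in> P" for u
      using seidel_row_sum[of u b "r - a" z, OF that bc(1) rz zP zQ]
      unfolding rP zP[OF that] by blast+
    have Q: "r * z u \<le> (\<Sum>v\<in>verts G. seidel_weight G u v * z v)"
      "(\<Sum>v\<in>verts G. seidel_weight G u v * z v) = r * z u \<longleftrightarrow>
        out_degree G u = max_degree_on G Q \<and> (\<forall>v\<in>verts G. graph_dist G u v \<le> 3)"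
      if "u \<in> Q" for u
      using Q.seidel_row_sum[of u "r - a" b z, OF that rz bc(1) zQ zP]
      unfolding rQ zQ[OF that] by blast+
    have super: "r * z u \<le> (\<Sum>v\<in>verts G. seidel_weight G u v * z v)" if "u \<in> verts G" for u
      using that P(1) Q(1) verts_eq by blast
    have ball: "(\<forall>u\<in>verts G. R u) \<longleftrightarrow> (\<forall>u\<in>P. R u) \<and> (\<forall>u\<in>Q. R u)" for R
      unfolding verts_eq by blast
    have "(\<forall>u\<in>verts G. (\<Sum>v\<in>verts G. seidel_weight G u v * z v) = r * z u) \<longleftrightarrow>
        (\<forall>u\<in>P. out_degree G u = max_degree_on G P) \<and> (\<forall>u\<in>Q. out_degree G u = max_degree_on G Q)
        \<and> (\<forall>u\<in>verts G. \<forall>v\<in>verts G. graph_dist G u v \<le> 3)"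
      unfolding ball[of "\<lambda>u. _ u = _ u"] ball[of "\<lambda>u. \<forall>v\<in>verts G. graph_dist G u v \<le> 3"]
      using P(2) Q(2) by auto
    then show ?thesis
      using distance_seidel_radius_bounds[OF assms(7,8) z super] extremal_iff[OF ne] assms(4,5)
      by simp
  qed
  then show ?thesis unfolding formula by blast
qed

end
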